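(* Let $m\geq 1$, let $n_1,\ldots,n_m$ be positive integers, and put $n_{m+1}=n_1$. Then for any non-negative integers $j$ and $r$ with $j\leq m$, the expression $$\frac{1}{[n_1]}{n_1+n_{m}\brack n_1}^{-1}\sum_{k=1}^{n_1}[2k][k]^{2r}q^{jk^2-(r+1)k}\prod_{i=1}^{m}{n_i+n_{i+1}\brack n_i+k}$$ is a Laurent polynomial in $q$ with integer coefficients.
   Context: Here $q$ is an indeterminate. For a non-negative integer $n$, the $q$-integer is $[n]=\frac{1-q^n}{1-q}=1+q+\cdots+q^{n-1}$. The $q$-shifted factorials are $(a;q)_0=1$ and $(a;q)_n=(1-a)(1-aq)\cdots(1-aq^{n-1})$ for $n\geq 1$. The $q$-binomial coefficients are ${n\brack k}=\frac{(q;q)_n}{(q;q)_k(q;q)_{n-k}}$ if $0\leq k\leq n$, and ${n\brack k}=0$ otherwise. The expression is a priori an element of the field $\mathbb{Q}(q)$; a Laurent polynomial with integer coefficients is an element of $\mathbb{Z}[q,q^{-1}]$. *)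

theory Defs
  imports "HOL-Computational_Algebra.Computational_Algebra"
begin

text \<open>
  The field \<open>\<rat>(q)\<close> is the fraction field of \<open>\<rat>[q]\<close>, i.e. the type
  \<open>rat poly fract\<close>; \<open>qvar\<close> is its indeterminate.
\<close>

definition qvar :: "rat poly fract" where
  "qvar = to_fract [:0, 1:]"

definition q_int :: "'a::field \<Rightarrow> nat \<Rightarrow> 'a" where
  "q_int q n = (1 - q ^ n) / (1 - q)"

definition q_pochhammer :: "'a::comm_ring_1 \<Rightarrow> 'a \<Rightarrow> nat \<Rightarrow> 'a" where
  "q_pochhammer a q n = (\<Prod>i<n. 1 - a * q ^ i)"

definition q_binomial :: "'a::field \<Rightarrow> nat \<Rightarrow> nat \<Rightarrow> 'a" where
  "q_binomial q n k =
     (if k \<le> n then q_pochhammer q q n / (q_pochhammer q q k * q_pochhammer q q (n - k)) else 0)"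

text \<open>
  \<open>\<int>[q, q\<^sup>-\<^sup>1]\<close> as a subset of \<open>\<rat>(q)\<close>: finite sums of integer multiples of integer powers of \<open>q\<close>.
\<close>

definition int_laurent_polys :: "rat poly fract set" where
  "int_laurent_polys =
     {\<Sum>e\<in>E. of_int (c e) * qvar powi e | (E :: int set) (c :: int \<Rightarrow> int). finite E}"

end

theory Submission
  imports Defs
begin

text \<open>
  Write \<open>(q)\<^sub>n\<close> for \<open>(q;q)\<^sub>n\<close> and \<open>A\<^sub>k(n) = 1 / ((q)\<^sub>n\<^sub>-\<^sub>k (q)\<^sub>n\<^sub>+\<^sub>k)\<close>, read as \<open>0\<close> when \<open>k > n\<close>.
  Regrouping the factors of the cyclic product of \<open>q\<close>-binomial coefficients gives
  \<open>\<Prod> (q)\<^bsub>n i + n (i + 1)\<^esub> * \<Prod> A\<^sub>k(n i)\<close>, so the summation index enters only through the functions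
  \<open>A\<^sub>k\<close>. The prefactor turns the closing factor \<open>(q)\<^bsub>n m + n 1\<^esub>\<close> of the cycle into \<open>(q)\<^bsub>n m\<^esub>\<close>,
  which is the factor obtained for \<open>n (m + 1) = 0\<close>. The cycle has become a path that ends in \<open>0\<close>;
  \<open>path_sum\<close> is the resulting expression.

  The \<open>q\<close>-Vandermonde identity expands \<open>(q)\<^sub>a\<^sub>+\<^sub>b A\<^sub>k(a) A\<^sub>k(b)\<close> linearly in the \<open>A\<^sub>k(s)\<close> with
  \<open>s \<le> min a b\<close>, and it does so in two ways: its two forms differ by a power of \<open>q\<close>, and one of
  them absorbs a factor \<open>q\<close> to the \<open>k\<^sup>2\<close> (\<open>inv_fact_pair_mult\<close>). Applied to the first two vertices of
  the path, it expresses a path sum through shorter ones (\<open>path_sum_merge\<close>). The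
  \<open>q\<close>-factorials left over assemble into \<open>q\<close>-binomial coefficients, so the coefficients
  of this expansion are polynomials. Every merge can lower \<open>j\<close> by one, hence \<open>j \<le> m\<close> leaves
  \<open>j \<le> 1\<close> when only one vertex remains.

  For one vertex, the sum telescopes when \<open>r = 0\<close>, to \<open>q\<close> to the power \<open>-n\<close> for \<open>j = 0\<close> and to \<open>1\<close>
  for \<open>j = 1\<close> (after normalisation). For larger \<open>r\<close>,
  the difference of \<open>[n]\<^sup>2 / q\<^sup>n\<close> and \<open>[k]\<^sup>2 / q\<^sup>k\<close> is, up to the factor \<open>q\<^sup>n (1 - q)\<^sup>2\<close> in the denominator,
  equal to \<open>(1 - q\<^sup>n\<^sup>-\<^sup>k) (1 - q\<^sup>n\<^sup>+\<^sup>k) = A\<^sub>k(n - 1) / A\<^sub>k(n)\<close>, which yields a recurrence in \<open>r\<close> with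
  coefficients in \<open>\<int>[q, q\<^sup>-\<^sup>1]\<close> (\<open>single_sum_Suc\<close>, \<open>single_sum_mem\<close>).
\<close>

section \<open>The \<open>q\<close>-binomial coefficients over a ring containing \<open>q\<close> and its inverse\<close>

text \<open>
  The argument uses about Laurent polynomials only that they form a ring containing \<open>q\<close> and \<open>q\<^sup>-\<^sup>1\<close>,
  and about the indeterminate only that it is nonzero and not a root of unity.
\<close>

locale generic_q_subring =
  fixes q :: "'a::field" and R :: "'a set"
  assumes q_nonzero: "q \<noteq> 0"
    and q_power_neq_1: "n > 0 \<Longrightarrow> q ^ n \<noteq> 1"
    and one_mem: "1 \<in> R"
    and q_mem: "q \<in> R"
    and inverse_q_mem: "inverse q \<in> R"
    and diff_mem: "x \<in> R \<Longrightarrow> y \<in> R \<Longrightarrow> x - y \<in> R"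
    and mult_mem: "x \<in> R \<Longrightarrow> y \<in> R \<Longrightarrow> x * y \<in> R"
begin

lemma q_neq_1: "q \<noteq> 1" "1 - q \<noteq> 0"
  using q_power_neq_1[of 1] by auto

lemma zero_mem: "0 \<in> R"
  using diff_mem[OF one_mem one_mem] by simp

lemma add_mem: "x \<in> R \<Longrightarrow> y \<in> R \<Longrightarrow> x + y \<in> R"
  using diff_mem[of x "0 - y"] diff_mem[OF zero_mem, of y] by simp

lemma sum_mem: "(\<And>x. x \<in> S \<Longrightarrow> f x \<in> R) \<Longrightarrow> sum f S \<in> R"
  by (induction S rule: infinite_finite_induct) (auto intro: zero_mem add_mem)

lemma power_mem: "x \<in> R \<Longrightarrow> x ^ n \<in> R"
  by (induction n) (auto intro: one_mem mult_mem)

lemma q_int_mem: "q_int q n \<in> R"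
proof -
  have "q_int q n = (\<Sum>i<n. q ^ i)"
    using q_neq_1 by (simp add: q_int_def one_diff_power_eq)
  then show ?thesis
    by (auto intro: sum_mem power_mem q_mem)
qed

abbreviation qfact :: "nat \<Rightarrow> 'a" where
  "qfact \<equiv> q_pochhammer q q"

lemma qfact_0 [simp]: "qfact 0 = 1"
  by (simp add: q_pochhammer_def)

lemma qfact_Suc: "qfact (Suc n) = (1 - q ^ Suc n) * qfact n"
  by (simp add: q_pochhammer_def)

lemma qfact_nonzero [simp]: "qfact n \<noteq> 0"
  using q_power_neq_1[of "Suc n" for n] by (auto simp: q_pochhammer_def simp flip: power_Suc)

lemma q_binomial_0 [simp]: "q_binomial q n 0 = 1"
  by (simp add: q_binomial_def)

lemma q_binomial_eq_0: "n < k \<Longrightarrow> q_binomial q n k = 0"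
  by (simp add: q_binomial_def)

text \<open>
  This Pascal rule comes from splitting \<open>1 - q\<^bsup>n + 1\<^esup>\<close> as
  \<open>(1 - q\<^bsup>n - k\<^esup>) + q\<^bsup>n - k\<^esup> (1 - q\<^bsup>k + 1\<^esup>)\<close>. The truncated exponent for \<open>n < k\<close> is harmless because its
  coefficient vanishes.
\<close>
lemma q_binomial_Suc_Suc:
  "q_binomial q (Suc n) (Suc k) = q_binomial q n (Suc k) + q ^ (n - k) * q_binomial q n k"
proof -
  consider "n < k" | "n = k" | d where "n = Suc (k + d)"
    using less_iff_Suc_add linorder_less_linear by blast
  then show ?thesis
  proof cases
    case 3
    have nz: "1 - q ^ Suc k \<noteq> 0" "1 - q ^ Suc d \<noteq> 0"
      using q_power_neq_1[of "Suc k"] q_power_neq_1[of "Suc d"] by auto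
    have split: "1 - q ^ Suc n = (1 - q ^ Suc d) + q ^ Suc d * (1 - q ^ Suc k)"
      by (simp add: 3 power_add algebra_simps)
    have "q_binomial q (Suc n) (Suc k)
        = (1 - q ^ Suc n) * (qfact n / (qfact (Suc k) * qfact (Suc d)))"
      by (simp add: q_binomial_def 3 qfact_Suc)
    also have "\<dots> = (1 - q ^ Suc d) * (qfact n / (qfact (Suc k) * qfact (Suc d)))
        + q ^ Suc d * ((1 - q ^ Suc k) * (qfact n / (qfact (Suc k) * qfact (Suc d))))"
      unfolding split by (simp only: algebra_simps)
    also have "(1 - q ^ Suc d) * (qfact n / (qfact (Suc k) * qfact (Suc d)))
        = q_binomial q n (Suc k)"
      using nz by (simp add: q_binomial_def 3 qfact_Suc[of d] del: power_Suc)
    also have "(1 - q ^ Suc k) * (qfact n / (qfact (Suc k) * qfact (Suc d)))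
        = q_binomial q n k"
      using nz by (simp add: q_binomial_def 3 qfact_Suc[of k] Suc_diff_le del: power_Suc)
    finally show ?thesis
      by (simp add: 3)
  qed (simp_all add: q_binomial_def)
qed

lemma q_binomial_mem: "q_binomial q n k \<in> R"
proof (induction n arbitrary: k)
  case 0
  then show ?case
    by (cases k) (auto simp: q_binomial_eq_0 intro: one_mem zero_mem)
next
  case (Suc n)
  then show ?case
    by (cases k) (auto simp: q_binomial_Suc_Suc intro: one_mem add_mem mult_mem power_mem q_mem)
qed

text \<open>
  Induction on \<open>N\<close>: the Pascal rule in the last factor splits the sum, and in the part that lowers
  \<open>L\<close> the exponents differ from those required by the constant \<open>M + N + 1 - L\<close>, independent of \<open>i\<close>.
\<close>
lemma q_Vandermonde:
  "q_binomial q (M + N) L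
     = (\<Sum>i\<le>L. q ^ ((M - i) * (L - i)) * q_binomial q M i * q_binomial q N (L - i))"
proof (induction N arbitrary: L)
  case 0
  have "(\<Sum>i\<le>L. q ^ ((M - i) * (L - i)) * q_binomial q M i * q_binomial q 0 (L - i))
      = (\<Sum>i\<le>L. if i = L then q_binomial q M L else 0)"
    by (intro sum.cong) (auto simp: q_binomial_eq_0)
  then show ?case
    by simp
next
  case (Suc N)
  show ?case
  proof (cases L)
    case (Suc l)
    let ?b = "q_binomial q"
    have shift: "q ^ ((M - i) * (L - i)) * ?b M i * (q ^ (N - (l - i)) * ?b N (l - i))
        = q ^ (M + N - l) * (q ^ ((M - i) * (l - i)) * ?b M i * ?b N (l - i))"
      if "i \<le> l" for i
    proof (cases "i \<le> M \<and> l - i \<le> N")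
      case True
      then obtain u v w where "M = i + u" "l = i + v" "N = v + w"
        using \<open>i \<le> l\<close> by (intro that[of "M - i" "l - i" "N - (l - i)"]) auto
      then have "(M - i) * (L - i) + (N - (l - i)) = (M + N - l) + (M - i) * (l - i)"
        using Suc by simp
      then have "q ^ ((M - i) * (L - i)) * q ^ (N - (l - i))
          = q ^ (M + N - l) * q ^ ((M - i) * (l - i))"
        by (simp only: power_add [symmetric])
      then show ?thesis
        by (simp add: mult_ac)
    qed (auto simp: q_binomial_eq_0 not_le)
    have "(\<Sum>i\<le>L. q ^ ((M - i) * (L - i)) * ?b M i * ?b (Suc N) (L - i))
        = (\<Sum>i\<le>l. q ^ ((M - i) * (L - i)) * ?b M i * ?b N (L - i)
            + q ^ ((M - i) * (L - i)) * ?b M i * (q ^ (N - (l - i)) * ?b N (l - i)))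
          + ?b M L"
      by (simp add: Suc Suc_diff_le q_binomial_Suc_Suc distrib_left)
    also have "\<dots> = (\<Sum>i\<le>L. q ^ ((M - i) * (L - i)) * ?b M i * ?b N (L - i))
          + (\<Sum>i\<le>l. q ^ ((M - i) * (L - i)) * ?b M i * (q ^ (N - (l - i)) * ?b N (l - i)))"
      by (simp add: Suc sum.distrib)
    also have "\<dots> = ?b (M + N) L + q ^ (M + N - l) * ?b (M + N) l"
      unfolding Suc.IH sum_distrib_left
      by (intro arg_cong2[where f = "(+)"] refl sum.cong shift) simp
    also have "\<dots> = ?b (M + Suc N) L"
      by (simp add: Suc q_binomial_Suc_Suc)
    finally show ?thesis ..
  qed simp
qed

section \<open>Linearising products of inverse factorial pairs\<close>

text \<open>
  This is \<open>q_binomial q (2 * n) (n + k)\<close> divided by \<open>qfact (2 * n)\<close>; the value \<open>0\<close> for \<open>k > n\<close> lets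
  sums over \<open>k\<close> be extended or cut off freely.
\<close>

definition inv_fact_pair :: "nat \<Rightarrow> nat \<Rightarrow> 'a" where
  "inv_fact_pair k n = (if k \<le> n then 1 / (qfact (n - k) * qfact (n + k)) else 0)"

lemma q_binomial_pair_eq_inv_fact_pair:
  assumes "k \<le> a" "k \<le> b" "s \<le> a" "s \<le> b"
  shows "q_binomial q (a - k) (a - s) * q_binomial q (b + k) (s + k)
           = qfact (a - k) * qfact (b + k) * (inv_fact_pair k s / (qfact (a - s) * qfact (b - s)))"
proof (cases "k \<le> s")
  case False
  with assms have "a - k < a - s"
    by linarith
  with False show ?thesis
    by (simp add: q_binomial_eq_0 inv_fact_pair_def)
qed (use assms in \<open>simp add: q_binomial_def inv_fact_pair_def\<close>)

text \<open>
  With \<open>M = a - k\<close>, \<open>N = b + k\<close>, \<open>L = a + k\<close> and \<open>i = a - s\<close>, the terms of the \<open>q\<close>-Vandermonde sum are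
  multiples of \<open>inv_fact_pair k s\<close> with exponent \<open>(s - k) (s + k) = s\<^sup>2 - k\<^sup>2\<close>; its \<open>k\<close>-dependent part
  is what multiplication by \<open>q\<close> to the power \<open>k\<^sup>2\<close> cancels. Exchanging the roles of \<open>M\<close> and \<open>N\<close> gives
  the same terms with the exponent \<open>(a - s) (b - s)\<close>, which is free of \<open>k\<close> from the start.
\<close>
lemma inv_fact_pair_mult:
  assumes "k > 0"
  shows "q ^ (k\<^sup>2) * qfact (a + b) * inv_fact_pair k a * inv_fact_pair k b
       = (\<Sum>s = 1..min a b. q ^ (s\<^sup>2) / (qfact (a - s) * qfact (b - s)) * inv_fact_pair k s)"
    (is ?V1)
  and "qfact (a + b) * inv_fact_pair k a * inv_fact_pair k b
       = (\<Sum>s = 1..min a b.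
            q ^ ((a - s) * (b - s)) / (qfact (a - s) * qfact (b - s)) * inv_fact_pair k s)"
    (is ?V0)
proof -
  have "?V1 \<and> ?V0"
  proof (cases "k \<le> a \<and> k \<le> b")
    case False
    then show ?thesis
      by (auto simp: inv_fact_pair_def intro!: sum.neutral)
  next
    case True
    then have k: "k \<le> a" "k \<le> b"
      by auto
    let ?c = "qfact (a - k) * qfact (b + k)"
    let ?t = "\<lambda>s. inv_fact_pair k s / (qfact (a - s) * qfact (b - s))"
    have ab: "a + b = (a - k) + (b + k)" "a + b = (b + k) + (a - k)"
      using k by auto
    have lhs: "q_binomial q (a + b) (a + k)
        = ?c * (qfact (a + b) * inv_fact_pair k a * inv_fact_pair k b)"
      using k by (simp add: q_binomial_def inv_fact_pair_def)
    (* Terms with s < k vanish; starting at 1 makes the range of s independent of k. *)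
    have support: "(\<Sum>s = k..min a b. q ^ f s * (?c * ?t s))
        = (\<Sum>s = 1..min a b. q ^ f s * (?c * ?t s))" for f
      by (intro sum.mono_neutral_left) (use assms in \<open>auto simp: inv_fact_pair_def\<close>)
    have "q_binomial q (a + b) (a + k) = (\<Sum>i\<le>a + k. q ^ ((a - k - i) * (a + k - i))
        * q_binomial q (a - k) i * q_binomial q (b + k) (a + k - i))"
      by (subst ab(1), subst q_Vandermonde) simp
    also have "\<dots> = (\<Sum>i = a - min a b..a - k. q ^ ((a - k - i) * (a + k - i))
        * q_binomial q (a - k) i * q_binomial q (b + k) (a + k - i))"
      by (intro sum.mono_neutral_right) (use k in \<open>auto simp: q_binomial_eq_0\<close>)
    also have "\<dots> = (\<Sum>s = k..min a b. q ^ ((s - k) * (s + k)) * (?c * ?t s))"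
    proof (rule sum.reindex_bij_witness [where i = "\<lambda>s. a - s" and j = "\<lambda>i. a - i"])
      fix i assume "i \<in> {a - min a b..a - k}"
      then have "k \<le> a - i" "i \<le> a" "a - i \<le> b"
        using k by auto
      then show "q ^ ((a - i - k) * (a - i + k)) * (?c * ?t (a - i))
          = q ^ ((a - k - i) * (a + k - i)) * q_binomial q (a - k) i
            * q_binomial q (b + k) (a + k - i)"
        using q_binomial_pair_eq_inv_fact_pair[OF k, of "a - i"]
        by (simp add: mult.assoc diff_right_commute add.commute[of k i])
    qed (use k in auto)
    also note support
    finally have 1: "q_binomial q (a + b) (a + k)
        = (\<Sum>s = 1..min a b. q ^ ((s - k) * (s + k)) * (?c * ?t s))" .
    have "q_binomial q (a + b) (a + k) = (\<Sum>i\<le>a + k. q ^ ((b + k - i) * (a + k - i))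
        * q_binomial q (b + k) i * q_binomial q (a - k) (a + k - i))"
      by (subst ab(2), subst q_Vandermonde) simp
    also have "\<dots> = (\<Sum>i = 2 * k..min a b + k. q ^ ((b + k - i) * (a + k - i))
        * q_binomial q (b + k) i * q_binomial q (a - k) (a + k - i))"
      by (intro sum.mono_neutral_right) (use k in \<open>auto simp: q_binomial_eq_0\<close>)
    also have "\<dots> = (\<Sum>s = k..min a b. q ^ ((a - s) * (b - s)) * (?c * ?t s))"
    proof (rule sum.reindex_bij_witness [where i = "\<lambda>s. s + k" and j = "\<lambda>i. i - k"])
      fix i assume "i \<in> {2 * k..min a b + k}"
      then have "2 * k \<le> i" "i - k \<le> a" "i - k \<le> b"
        by auto
      then show "q ^ ((a - (i - k)) * (b - (i - k))) * (?c * ?t (i - k))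
          = q ^ ((b + k - i) * (a + k - i)) * q_binomial q (b + k) i
            * q_binomial q (a - k) (a + k - i)"
        using q_binomial_pair_eq_inv_fact_pair[OF k, of "i - k"]
        by (simp add: mult.assoc mult.commute[of "a + k - i"]
            mult.commute[of "q_binomial q (b + k) i"])
    qed auto
    also note support
    finally have 0: "q_binomial q (a + b) (a + k)
        = (\<Sum>s = 1..min a b. q ^ ((a - s) * (b - s)) * (?c * ?t s))" .
    have sq: "q ^ (k\<^sup>2) * (q ^ ((s - k) * (s + k)) * (?c * ?t s)) = ?c * (q ^ (s\<^sup>2) * ?t s)" for s
    proof (cases "k \<le> s")
      case True
      then obtain d where "s = k + d"
        using le_Suc_ex by blast
      then have "k\<^sup>2 + (s - k) * (s + k) = s\<^sup>2"
        by (simp add: power2_eq_square algebra_simps)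
      then have "q ^ (k\<^sup>2) * q ^ ((s - k) * (s + k)) = q ^ (s\<^sup>2)"
        by (simp only: power_add [symmetric])
      then have "q ^ (k\<^sup>2) * (q ^ ((s - k) * (s + k)) * (?c * ?t s)) = q ^ (s\<^sup>2) * (?c * ?t s)"
        by (simp only: mult.assoc [symmetric])
      then show ?thesis
        by (simp only: mult.left_commute)
    qed (simp add: inv_fact_pair_def)
    have "?c * (q ^ (k\<^sup>2) * qfact (a + b) * inv_fact_pair k a * inv_fact_pair k b)
        = q ^ (k\<^sup>2) * q_binomial q (a + b) (a + k)"
      unfolding lhs by (simp only: mult_ac)
    also have "\<dots> = ?c * (\<Sum>s = 1..min a b. q ^ (s\<^sup>2) * ?t s)"
      unfolding 1 sum_distrib_left sq ..
    finally have V1: ?V1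
      by simp
    have "?c * (qfact (a + b) * inv_fact_pair k a * inv_fact_pair k b)
        = ?c * (\<Sum>s = 1..min a b. q ^ ((a - s) * (b - s)) * ?t s)"
      using 0 lhs by (simp add: sum_distrib_left mult_ac)
    then have ?V0
      by simp
    with V1 show ?thesis ..
  qed
  then show ?V1 ?V0
    by auto
qed

text \<open>
  The two expansions combined: a positive power \<open>j\<close> is lowered by one, and \<open>j = 0\<close> stays \<open>0\<close> by
  truncated subtraction. That the exponents \<open>e s\<close> are natural numbers independent of \<open>k\<close> is what
  keeps the coefficients of \<open>path_sum_merge\<close> integral and lets them be taken out of the sum over \<open>k\<close>.
\<close>
lemma inv_fact_pair_mult_q_power:
  obtains e :: "nat \<Rightarrow> nat" where
    "\<And>k. k > 0 \<Longrightarrow>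
       q ^ (j * k\<^sup>2) * (qfact (a + b) * inv_fact_pair k a * inv_fact_pair k b)
         = (\<Sum>s = 1..min a b. q ^ e s / (qfact (a - s) * qfact (b - s))
              * (q ^ ((j - 1) * k\<^sup>2) * inv_fact_pair k s))"
proof (cases j)
  case 0
  show ?thesis
    by (rule that[of "\<lambda>s. (a - s) * (b - s)"]) (simp add: 0 inv_fact_pair_mult(2))
next
  case (Suc i)
  show ?thesis
  proof (rule that[of "\<lambda>s. s\<^sup>2"])
    fix k :: nat assume "k > 0"
    have "q ^ (j * k\<^sup>2) * (qfact (a + b) * inv_fact_pair k a * inv_fact_pair k b)
        = q ^ (i * k\<^sup>2) * (q ^ (k\<^sup>2) * qfact (a + b) * inv_fact_pair k a * inv_fact_pair k b)"
      by (simp add: Suc power_add mult_ac)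
    also have "\<dots> = (\<Sum>s = 1..min a b. q ^ (s\<^sup>2) / (qfact (a - s) * qfact (b - s))
              * (q ^ ((j - 1) * k\<^sup>2) * inv_fact_pair k s))"
      unfolding inv_fact_pair_mult(1)[OF \<open>k > 0\<close>] sum_distrib_left by (simp add: Suc mult_ac)
    finally show "q ^ (j * k\<^sup>2) * (qfact (a + b) * inv_fact_pair k a * inv_fact_pair k b)
        = (\<Sum>s = 1..min a b. q ^ (s\<^sup>2) / (qfact (a - s) * qfact (b - s))
              * (q ^ ((j - 1) * k\<^sup>2) * inv_fact_pair k s))" .
  qed
qed

section \<open>Sums with a single vertex\<close>

text \<open>
  The factor \<open>q\<^bsup>- (r + 1) k\<^esup>\<close> of the summand is distributed over \<open>[2k]\<close> and the \<open>r\<close> copies of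
  \<open>[k]\<^sup>2\<close>, so that passing from \<open>r\<close> to \<open>r + 1\<close> is multiplication by \<open>[k]\<^sup>2 / q\<^sup>k\<close>. In this
  form both factors are, up to sign, invariant under \<open>k \<mapsto> -k\<close>, as is \<open>A\<^sub>k(n)\<close>.
\<close>

definition weight :: "nat \<Rightarrow> nat \<Rightarrow> 'a" where
  "weight r k = q_int q (2 * k) / q ^ k * ((q_int q k)\<^sup>2 / q ^ k) ^ r"

definition single_sum :: "nat \<Rightarrow> nat \<Rightarrow> nat \<Rightarrow> 'a" where
  "single_sum r j n = (\<Sum>k = 1..n. weight r k * q ^ (j * k\<^sup>2) * inv_fact_pair k n)"

text \<open>
  The terms whose differences telescope: \<open>inv_fact_pair k n\<close> lies between \<open>half_shifted_pair k n\<close> and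
  \<open>half_shifted_pair (Suc k) n\<close>, being linked to them by one factor each.
\<close>
definition half_shifted_pair :: "nat \<Rightarrow> nat \<Rightarrow> 'a" where
  "half_shifted_pair k n = (if k \<le> n then 1 / (qfact (n - k) * qfact (n + k - 1)) else 0)"

lemma half_shifted_pair_eq:
  assumes "1 \<le> k" "k \<le> n"
  shows "half_shifted_pair k n = (1 - q ^ (n + k)) * inv_fact_pair k n"
    and "half_shifted_pair (Suc k) n = (1 - q ^ (n - k)) * inv_fact_pair k n"
proof -
  have "1 - q ^ (n + k) \<noteq> 0" "qfact (n + k) = (1 - q ^ (n + k)) * qfact (n + k - 1)"
    using q_power_neq_1[of "n + k"] qfact_Suc[of "n + k - 1"] assms by auto
  then show "half_shifted_pair k n = (1 - q ^ (n + k)) * inv_fact_pair k n"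
    using assms by (simp add: half_shifted_pair_def inv_fact_pair_def)
  show "half_shifted_pair (Suc k) n = (1 - q ^ (n - k)) * inv_fact_pair k n"
  proof (cases "k = n")
    case False
    then have "1 - q ^ (n - k) \<noteq> 0" "qfact (n - k) = (1 - q ^ (n - k)) * qfact (n - Suc k)"
      using q_power_neq_1[of "n - k"] qfact_Suc[of "n - Suc k"] assms
      by (auto simp: Suc_diff_Suc)
    with False show ?thesis
      using assms by (simp add: half_shifted_pair_def inv_fact_pair_def)
  qed (simp add: half_shifted_pair_def)
qed

lemma sum_telescope_half_shifted:
  assumes "n > 0"
  shows "(\<Sum>k = 1..n. q ^ (f k) * half_shifted_pair k n - q ^ f (Suc k) * half_shifted_pair (Suc k) n)
           = q ^ f 1 / (qfact (n - 1) * qfact n)"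
proof -
  let ?T = "\<lambda>k. q ^ f k * half_shifted_pair k n"
  have "(\<Sum>k = 1..n. ?T k - ?T (Suc k)) = - (\<Sum>k = 1..n. ?T (Suc k) - ?T k)"
    by (simp add: sum_negf [symmetric])
  also have "\<dots> = ?T 1 - ?T (Suc n)"
    using assms by (subst sum_Suc_diff) auto
  finally show ?thesis
    using assms by (simp add: half_shifted_pair_def)
qed

text \<open>
  Here \<open>q\<^sup>n (1 - q\<^sup>2\<^sup>k) / q\<^sup>k\<close> is the difference of \<open>1 - q\<^sup>n\<^sup>+\<^sup>k\<close> and \<open>1 - q\<^sup>n\<^sup>-\<^sup>k\<close>, the two factors that link
  the summand to its neighbours.
\<close>
lemma single_sum_0_0:
  assumes "n > 0"
  shows "(1 - q) * qfact (n - 1) * qfact n * single_sum 0 0 n = inverse (q ^ n)"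
proof -
  have "(1 - q) * q ^ n * (weight 0 k * q ^ (0 * k\<^sup>2) * inv_fact_pair k n)
      = q ^ 0 * half_shifted_pair k n - q ^ 0 * half_shifted_pair (Suc k) n"
    if "k \<in> {1..n}" for k
  proof -
    have "q ^ n * (1 - q ^ (2 * k)) / q ^ k = (1 - q ^ (n + k)) - (1 - q ^ (n - k))"
      using that q_nonzero by (simp add: power_diff power_add mult_2_right field_simps)
    moreover have "(1 - q) * q ^ n * (weight 0 k * q ^ (0 * k\<^sup>2) * inv_fact_pair k n)
        = q ^ n * (1 - q ^ (2 * k)) / q ^ k * inv_fact_pair k n"
      using q_neq_1 by (simp add: weight_def q_int_def)
    ultimately show ?thesis
      using that half_shifted_pair_eq[of k n] by (simp only: left_diff_distrib) simp
  qed
  then have "(1 - q) * q ^ n * single_sum 0 0 n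
      = (\<Sum>k = 1..n. q ^ 0 * half_shifted_pair k n - q ^ 0 * half_shifted_pair (Suc k) n)"
    unfolding single_sum_def sum_distrib_left by (intro sum.cong) auto
  also have "\<dots> = 1 / (qfact (n - 1) * qfact n)"
    using sum_telescope_half_shifted[OF assms, of "\<lambda>_. 0"] by simp
  finally show ?thesis
    using q_nonzero by (simp add: field_simps)
qed

text \<open>
  As for \<open>j = 0\<close>, but with \<open>1 - q\<^sup>2\<^sup>k = (1 - q\<^sup>n\<^sup>+\<^sup>k) - q\<^sup>2\<^sup>k (1 - q\<^sup>n\<^sup>-\<^sup>k)\<close>; the exponent \<open>k (k - 1)\<close> grows by
  exactly \<open>2k\<close> from \<open>k\<close> to \<open>k + 1\<close>.
\<close>
lemma single_sum_0_1:
  assumes "n > 0"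
  shows "(1 - q) * qfact (n - 1) * qfact n * single_sum 0 1 n = 1"
proof -
  let ?f = "\<lambda>k. k * (k - 1)"
  have "(1 - q) * (weight 0 k * q ^ (1 * k\<^sup>2) * inv_fact_pair k n)
      = q ^ ?f k * half_shifted_pair k n - q ^ ?f (Suc k) * half_shifted_pair (Suc k) n"
    if "k \<in> {1..n}" for k
  proof -
    have "k\<^sup>2 = ?f k + k" and step: "?f (Suc k) = ?f k + 2 * k"
      using that by (cases k; simp add: power2_eq_square)+
    then have pow: "q ^ (k\<^sup>2) / q ^ k = q ^ ?f k"
      using q_nonzero by (simp only: power_add) simp
    have "(1 - q) * (weight 0 k * q ^ (1 * k\<^sup>2) * inv_fact_pair k n)
        = q ^ (k\<^sup>2) / q ^ k * (1 - q ^ (2 * k)) * inv_fact_pair k n"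
      using q_neq_1 by (simp add: weight_def q_int_def)
    also note pow
    finally have "(1 - q) * (weight 0 k * q ^ (1 * k\<^sup>2) * inv_fact_pair k n)
        = q ^ ?f k * (1 - q ^ (2 * k)) * inv_fact_pair k n" .
    moreover have "1 - q ^ (2 * k) = (1 - q ^ (n + k)) - q ^ (2 * k) * (1 - q ^ (n - k))"
      using that by (simp add: right_diff_distrib add.commute flip: power_add)
    moreover have "q ^ ?f k * half_shifted_pair k n - q ^ ?f (Suc k) * half_shifted_pair (Suc k) n
        = q ^ ?f k * ((1 - q ^ (n + k)) - q ^ (2 * k) * (1 - q ^ (n - k))) * inv_fact_pair k n"
      unfolding step power_add [of q "?f k" "2 * k"] using that half_shifted_pair_eq[of k n]
      by (simp only: atLeastAtMost_iff left_diff_distrib right_diff_distrib mult.assoc)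
    ultimately show ?thesis
      by (simp only:)
  qed
  then have "(1 - q) * single_sum 0 1 n
      = (\<Sum>k = 1..n. q ^ ?f k * half_shifted_pair k n - q ^ ?f (Suc k) * half_shifted_pair (Suc k) n)"
    unfolding single_sum_def sum_distrib_left by (intro sum.cong) auto
  also have "\<dots> = 1 / (qfact (n - 1) * qfact n)"
    using sum_telescope_half_shifted[OF assms, of ?f] by simp
  finally show ?thesis
    by (simp add: field_simps)
qed

text \<open>
  Since \<open>(1 - q\<^sup>k)\<^sup>2 / q\<^sup>k = q\<^sup>k + q\<^sup>-\<^sup>k - 2\<close>, the values for \<open>n\<close> and \<open>k\<close> differ by
  \<open>(1 - q\<^sup>n\<^sup>-\<^sup>k) (1 - q\<^sup>n\<^sup>+\<^sup>k) / q\<^sup>n\<close>, and these two factors lower \<open>n\<close> to \<open>n - 1\<close> in \<open>inv_fact_pair k n\<close>.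
\<close>
lemma inv_fact_pair_lower:
  assumes "1 \<le> k" "k \<le> n"
  shows "(q_int q k)\<^sup>2 / q ^ k * inv_fact_pair k n
           = (q_int q n)\<^sup>2 / q ^ n * inv_fact_pair k n
             - inv_fact_pair k (n - 1) / (q ^ n * (1 - q)\<^sup>2)"
proof -
  have "inv_fact_pair k (n - 1) = (1 - q ^ (n + k)) * half_shifted_pair (Suc k) n"
  proof (cases "k = n")
    case False
    then have "1 - q ^ (n + k) \<noteq> 0" "qfact (n + k) = (1 - q ^ (n + k)) * qfact (n - 1 + k)"
      using q_power_neq_1[of "n + k"] qfact_Suc[of "n - 1 + k"] assms by auto
    with False show ?thesis
      using assms by (simp add: half_shifted_pair_def inv_fact_pair_def)
  qed (use assms in \<open>simp add: half_shifted_pair_def inv_fact_pair_def\<close>)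
  then have "inv_fact_pair k (n - 1) = (1 - q ^ (n - k)) * (1 - q ^ (n + k)) * inv_fact_pair k n"
    by (simp add: half_shifted_pair_eq[OF assms])
  moreover have "(1 - q ^ k)\<^sup>2 / q ^ k
      = (1 - q ^ n)\<^sup>2 / q ^ n - (1 - q ^ (n - k)) * (1 - q ^ (n + k)) / q ^ n"
    using q_nonzero assms by (simp add: field_simps power_diff power_add power2_eq_square)
  then have "(q_int q k)\<^sup>2 / q ^ k = (q_int q n)\<^sup>2 / q ^ n
      - (1 - q ^ (n - k)) * (1 - q ^ (n + k)) / (q ^ n * (1 - q)\<^sup>2)"
    using q_neq_1 q_nonzero by (simp add: q_int_def field_simps)
  ultimately show ?thesis
    by (simp add: left_diff_distrib)
qed

lemma single_sum_Suc:
  assumes "n > 0"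
  shows "single_sum (Suc r) j n = (q_int q n)\<^sup>2 / q ^ n * single_sum r j n
           - single_sum r j (n - 1) / (q ^ n * (1 - q)\<^sup>2)"
proof -
  have "single_sum r j (n - 1) = (\<Sum>k = 1..n. weight r k * q ^ (j * k\<^sup>2) * inv_fact_pair k (n - 1))"
    unfolding single_sum_def
    by (intro sum.mono_neutral_left) (use assms in \<open>auto simp: inv_fact_pair_def\<close>)
  moreover have "single_sum (Suc r) j n
      = (\<Sum>k = 1..n. weight r k * q ^ (j * k\<^sup>2) * ((q_int q k)\<^sup>2 / q ^ k * inv_fact_pair k n))"
    unfolding single_sum_def by (simp add: weight_def mult_ac)
  moreover have "\<dots> = (\<Sum>k = 1..n. weight r k * q ^ (j * k\<^sup>2)
      * ((q_int q n)\<^sup>2 / q ^ n * inv_fact_pair k n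
             - inv_fact_pair k (n - 1) / (q ^ n * (1 - q)\<^sup>2)))"
    using assms by (intro sum.cong refl) (subst inv_fact_pair_lower, auto)
  ultimately show ?thesis
    by (simp add: single_sum_def sum_subtractf sum_distrib_left sum_divide_distrib
        right_diff_distrib mult_ac)
qed

text \<open>
  Normalised by \<open>(1 - q) (q)\<^sub>n\<^sub>-\<^sub>1 (q)\<^sub>n\<close>, the recurrence in \<open>r\<close> loses its denominator \<open>(1 - q)\<^sup>2\<close>: the
  factors \<open>1 - q\<^sup>n\<close> and \<open>1 - q\<^sup>n\<^sup>-\<^sup>1\<close> that separate the normalisations for \<open>n\<close> and \<open>n - 1\<close> turn it into
  the \<open>q\<close>-integers \<open>[n]\<close> and \<open>[n - 1]\<close>.
\<close>
lemma single_sum_mem: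
  assumes "n > 0" "j \<le> 1"
  shows "(1 - q) * qfact (n - 1) * qfact n * single_sum r j n \<in> R"
  using assms(1)
proof (induction r arbitrary: n)
  case 0
  from assms(2) consider "j = 0" | "j = 1"
    by linarith
  then show ?case
    using 0 single_sum_0_0 single_sum_0_1
    by cases (auto simp: power_inverse [symmetric] intro: one_mem power_mem inverse_q_mem)
next
  case (Suc r)
  let ?B = "\<lambda>n. (1 - q) * qfact (n - 1) * qfact n * single_sum r j n"
  have "(1 - q) * qfact (n - 1) * qfact n * single_sum (Suc r) j n
      = inverse q ^ n * ((q_int q n)\<^sup>2 * ?B n - q_int q n * q_int q (n - 1) * ?B (n - 1))"
  proof (cases "n = 1")
    case True
    then show ?thesis
      by (simp add: single_sum_Suc power_inverse divide_inverse) (simp add: single_sum_def q_int_def)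
  next
    case False
    then obtain p where n: "n = Suc (Suc p)"
      using Suc.prems by (metis One_nat_def not0_implies_Suc not_gr0)
    have "qfact (n - 1) * qfact n / (1 - q)\<^sup>2 = q_int q n * q_int q (n - 1) * (qfact p * qfact (n - 1))"
      using q_neq_1 by (simp add: n qfact_Suc[of p] qfact_Suc[of "Suc p"] q_int_def power2_eq_square)
    then have "(1 - q) * (qfact (n - 1) * qfact n / (1 - q)\<^sup>2) * single_sum r j (n - 1)
        = q_int q n * q_int q (n - 1) * ?B (n - 1)"
      by (simp add: n mult_ac)
    moreover have "(1 - q) * qfact (n - 1) * qfact n * single_sum (Suc r) j n
      = inverse q ^ n * ((q_int q n)\<^sup>2 * ?B n
          - (1 - q) * (qfact (n - 1) * qfact n / (1 - q)\<^sup>2) * single_sum r j (n - 1))"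
      unfolding single_sum_Suc[OF Suc.prems] using q_nonzero q_neq_1
      by (simp add: field_simps)
    ultimately show ?thesis
      by simp
  qed
  moreover have "?B n \<in> R"
    using Suc by blast
  moreover have "?B (n - 1) \<in> R"
    using Suc.IH[of "n - 1"] by (cases "n = 1") (use Suc.prems in \<open>auto simp: single_sum_def zero_mem\<close>)
  ultimately show ?case
    by (auto intro!: mult_mem diff_mem power_mem inverse_q_mem q_int_mem)
qed

section \<open>Sums along a path\<close>

text \<open>
  The vertices of the path are \<open>n 0, \<dots>, n m\<close>, and \<open>n (Suc m)\<close> contributes to the last factorial; it
  is going to be \<open>0\<close>. The sum may stop at \<open>n 0\<close> because \<open>inv_fact_pair k (n 0)\<close> vanishes beyond.
\<close>

definition path_sum :: "nat \<Rightarrow> nat \<Rightarrow> nat \<Rightarrow> (nat \<Rightarrow> nat) \<Rightarrow> 'a" where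
  "path_sum r j m n = (1 - q) * qfact (n 0 - 1) * (\<Prod>i\<le>m. qfact (n i + n (Suc i)))
     * (\<Sum>k = 1..n 0. weight r k * q ^ (j * k\<^sup>2) * (\<Prod>i\<le>m. inv_fact_pair k (n i)))"

text \<open>
  The vertices \<open>n 0\<close> and \<open>n 1\<close> are replaced by one vertex \<open>s\<close>, which uses up \<open>(q)\<^bsub>n 0 + n 1\<^esub>\<close>. Comparing
  the remaining factorials of the old and the new path gives
  \<open>(q)\<^bsub>n 0 - 1\<^esub> / ((q)\<^bsub>s - 1\<^esub> (q)\<^bsub>n 0 - s\<^esub>)\<close> and \<open>(q)\<^bsub>n 1 + n 2\<^esub> / ((q)\<^bsub>s + n 2\<^esub> (q)\<^bsub>n 1 - s\<^esub>)\<close>,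
  two \<open>q\<close>-binomial coefficients.
\<close>
lemma path_sum_merge:
  obtains e :: "nat \<Rightarrow> nat" where
    "path_sum r j (Suc m) n
       = (\<Sum>s = 1..min (n 0) (n 1).
            q ^ e s * q_binomial q (n 0 - 1) (s - 1) * q_binomial q (n 1 + n 2) (n 1 - s)
              * path_sum r (j - 1) m (case_nat s (\<lambda>i. n (i + 2))))"
proof -
  define a b c where "a = n 0" and "b = n 1" and "c = n 2"
  define rest where "rest = (\<lambda>k. \<Prod>i<m. inv_fact_pair k (n (i + 2)))"
  define facts where "facts = (\<Prod>i<m. qfact (n (i + 2) + n (Suc (i + 2))))"
  obtain e where e: "\<And>k. k > 0 \<Longrightarrow>
       q ^ (j * k\<^sup>2) * (qfact (a + b) * inv_fact_pair k a * inv_fact_pair k b)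
         = (\<Sum>s = 1..min a b. q ^ e s / (qfact (a - s) * qfact (b - s))
              * (q ^ ((j - 1) * k\<^sup>2) * inv_fact_pair k s))"
    using inv_fact_pair_mult_q_power[of j a b] by blast
  define inner where "inner = (\<lambda>s. \<Sum>k = 1..s.
      weight r k * q ^ ((j - 1) * k\<^sup>2) * (inv_fact_pair k s * rest k))"
  have old: "path_sum r j (Suc m) n = (1 - q) * qfact (a - 1) * qfact (b + c) * facts
      * (\<Sum>k = 1..a. weight r k * rest k
          * (q ^ (j * k\<^sup>2) * (qfact (a + b) * inv_fact_pair k a * inv_fact_pair k b)))"
    unfolding path_sum_def a_def b_def c_def rest_def facts_def sum_distrib_left
    by (simp add: prod.lessThan_Suc_shift numeral_2_eq_2 mult_ac del: prod.lessThan_Suc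
        flip: lessThan_Suc_atMost)
  have new: "path_sum r (j - 1) m (case_nat s (\<lambda>i. n (i + 2)))
      = (1 - q) * qfact (s - 1) * qfact (s + c) * facts * inner s" for s
    unfolding path_sum_def c_def rest_def facts_def inner_def
    by (simp add: prod.lessThan_Suc_shift numeral_2_eq_2 mult_ac del: prod.lessThan_Suc
        flip: lessThan_Suc_atMost)
  have "(\<Sum>k = 1..a. weight r k * rest k
          * (q ^ (j * k\<^sup>2) * (qfact (a + b) * inv_fact_pair k a * inv_fact_pair k b)))
      = (\<Sum>k = 1..a. \<Sum>s = 1..min a b. q ^ e s / (qfact (a - s) * qfact (b - s))
          * (weight r k * q ^ ((j - 1) * k\<^sup>2) * (inv_fact_pair k s * rest k)))"
  proof (intro sum.cong refl)
    fix k assume "k \<in> {1..a}"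
    then show "weight r k * rest k
          * (q ^ (j * k\<^sup>2) * (qfact (a + b) * inv_fact_pair k a * inv_fact_pair k b))
      = (\<Sum>s = 1..min a b. q ^ e s / (qfact (a - s) * qfact (b - s))
          * (weight r k * q ^ ((j - 1) * k\<^sup>2) * (inv_fact_pair k s * rest k)))"
      by (subst e) (simp_all add: sum_distrib_left mult_ac)
  qed
  also have "\<dots> = (\<Sum>s = 1..min a b. q ^ e s / (qfact (a - s) * qfact (b - s))
      * (\<Sum>k = 1..a. weight r k * q ^ ((j - 1) * k\<^sup>2) * (inv_fact_pair k s * rest k)))"
    by (subst sum.swap) (simp add: sum_distrib_left)
  also have "\<dots> = (\<Sum>s = 1..min a b. q ^ e s / (qfact (a - s) * qfact (b - s)) * inner s)"
  proof (intro sum.cong refl arg_cong2[where f = "(*)"])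
    fix s assume "s \<in> {1..min a b}"
    then show "(\<Sum>k = 1..a. weight r k * q ^ ((j - 1) * k\<^sup>2) * (inv_fact_pair k s * rest k))
        = inner s"
      unfolding inner_def by (intro sum.mono_neutral_right) (auto simp: inv_fact_pair_def)
  qed
  finally have "path_sum r j (Suc m) n
      = (\<Sum>s = 1..min a b. (1 - q) * qfact (a - 1) * qfact (b + c) * facts
          * (q ^ e s / (qfact (a - s) * qfact (b - s)) * inner s))"
    unfolding old by (simp add: sum_distrib_left)
  also have "\<dots> = (\<Sum>s = 1..min a b.
            q ^ e s * q_binomial q (a - 1) (s - 1) * q_binomial q (b + c) (b - s)
              * path_sum r (j - 1) m (case_nat s (\<lambda>i. n (i + 2))))"
  proof (intro sum.cong refl)
    fix s assume "s \<in> {1..min a b}"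
    then have "q_binomial q (a - 1) (s - 1) = qfact (a - 1) / (qfact (s - 1) * qfact (a - s))"
      and "q_binomial q (b + c) (b - s) = qfact (b + c) / (qfact (b - s) * qfact (s + c))"
      by (auto simp: q_binomial_def add.commute)
    then show "(1 - q) * qfact (a - 1) * qfact (b + c) * facts
          * (q ^ e s / (qfact (a - s) * qfact (b - s)) * inner s)
        = q ^ e s * q_binomial q (a - 1) (s - 1) * q_binomial q (b + c) (b - s)
              * path_sum r (j - 1) m (case_nat s (\<lambda>i. n (i + 2)))"
      unfolding new by simp
  qed
  finally show ?thesis
    unfolding a_def b_def c_def by (rule that)
qed

lemma path_sum_mem:
  assumes "n 0 > 0" "n (Suc m) = 0" "j \<le> Suc m"
  shows "path_sum r j m n \<in> R"
  using assms
proof (induction m arbitrary: n j)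
  case 0
  then show ?case
    using single_sum_mem[of "n 0" j r] by (simp add: path_sum_def single_sum_def)
next
  case (Suc m)
  obtain e where "path_sum r j (Suc m) n
       = (\<Sum>s = 1..min (n 0) (n 1).
            q ^ e s * q_binomial q (n 0 - 1) (s - 1) * q_binomial q (n 1 + n 2) (n 1 - s)
              * path_sum r (j - 1) m (case_nat s (\<lambda>i. n (i + 2))))"
    using path_sum_merge by blast
  moreover have "path_sum r (j - 1) m (case_nat s (\<lambda>i. n (i + 2))) \<in> R" if "s > 0" for s
    by (rule Suc.IH) (use that Suc.prems in auto)
  ultimately show ?case
    by (auto intro!: sum_mem mult_mem power_mem q_mem q_binomial_mem)
qed

section \<open>From the cycle to the path\<close>

text \<open>
  The \<open>q\<close>-binomial coefficient with index \<open>i\<close> has denominator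
  \<open>(q)\<^bsub>n i + k\<^esub> (q)\<^bsub>n (i + 1) - k\<^esub>\<close>; going around the cycle, the second factors can be shifted back by
  one index and meet the first.
\<close>

lemma prod_q_binomial_cycle:
  fixes n :: "nat \<Rightarrow> nat"
  assumes "n (m + 1) = n 1" "m \<ge> 1"
  shows "(\<Prod>i = 1..m. q_binomial q (n i + n (i + 1)) (n i + k))
    = (\<Prod>i = 1..m. qfact (n i + n (i + 1))) * (\<Prod>i = 1..m. inv_fact_pair k (n i))"
proof -
  define D where "D = (\<lambda>x. if k \<le> x then 1 / qfact (x - k) else 0)"
  have "(\<Prod>i = 1..m. q_binomial q (n i + n (i + 1)) (n i + k))
      = (\<Prod>i = 1..m. qfact (n i + n (i + 1)) * ((1 / qfact (n i + k)) * D (n (i + 1))))"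
    by (intro prod.cong) (auto simp: q_binomial_def D_def)
  also have "\<dots> = (\<Prod>i = 1..m. qfact (n i + n (i + 1)))
      * ((\<Prod>i = 1..m. 1 / qfact (n i + k)) * (\<Prod>i = 1..m. D (n (i + 1))))"
    by (simp only: prod.distrib)
  also have "(\<Prod>i = 1..m. D (n (i + 1))) = (\<Prod>i = Suc 1..Suc m. D (n i))"
    by (subst prod.shift_bounds_cl_Suc_ivl) simp
  also have "\<dots> = (\<Prod>i = Suc 1..m. D (n i)) * D (n 1)"
    using assms by (subst prod.nat_ivl_Suc') (auto simp: mult.commute)
  also have "\<dots> = (\<Prod>i = 1..m. D (n i))"
    using assms by (subst (2) prod.atLeast_Suc_atMost) (auto simp: mult.commute)
  also have "(\<Prod>i = 1..m. 1 / qfact (n i + k)) * \<dots> = (\<Prod>i = 1..m. inv_fact_pair k (n i))"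
    unfolding prod.distrib [symmetric] by (intro prod.cong) (auto simp: D_def inv_fact_pair_def)
  finally show ?thesis .
qed

lemma weight_eq:
  "q_int q (2 * k) * q_int q k ^ (2 * r) * q powi (int j * int k ^ 2 - (int r + 1) * int k)
     = weight r k * q ^ (j * k\<^sup>2)"
proof -
  have "q powi (int j * int k ^ 2 - (int r + 1) * int k)
      = q powi int (j * k\<^sup>2) / q powi int ((r + 1) * k)"
    using q_nonzero by (simp add: power_int_diff algebra_simps)
  also have "\<dots> = q ^ (j * k\<^sup>2) / (q ^ k * (q ^ k) ^ r)"
    unfolding power_int_of_nat by (simp add: power_add power_mult mult.commute)
  finally show ?thesis
    by (simp add: weight_def power_divide power_mult)
qed

theorem cyclic_sum_mem:
  assumes m: "m \<ge> 1" and pos: "\<And>i. i \<in> {1..m} \<Longrightarrow> n i > 0"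
    and cycle: "n (m + 1) = n 1" and j: "j \<le> m"
  shows "1 / q_int q (n 1) * inverse (q_binomial q (n 1 + n m) (n 1)) *
           (\<Sum>k = 1..n 1.
              q_int q (2 * k) * q_int q k ^ (2 * r) *
              q powi (int j * int k ^ 2 - (int r + 1) * int k) *
              (\<Prod>i = 1..m. q_binomial q (n i + n (i + 1)) (n i + k)))
         \<in> R"
proof -
  define p where "p = m - 1"
  (* The path that the cycle becomes: indices start at 0, and the vertex after the last is 0. *)
  define n' where "n' = (\<lambda>i. if i < m then n (Suc i) else 0)"
  have mp: "m = Suc p"
    using m by (simp add: p_def)
  have shift: "(\<Prod>i = 1..m. f i) = (\<Prod>i\<le>p. f (Suc i))" for f :: "nat \<Rightarrow> 'a"
    unfolding mp One_nat_def prod.shift_bounds_cl_Suc_ivl atMost_atLeast0 ..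
  have facts: "(\<Prod>i = 1..m. qfact (n i + n (i + 1))) * qfact (n m)
      = (\<Prod>i\<le>p. qfact (n' i + n' (Suc i))) * qfact (n 1 + n m)"
    unfolding shift using cycle
    by (simp add: mp n'_def add.commute prod.lessThan_Suc [symmetric] flip: lessThan_Suc_atMost)
  have pairs: "(\<Prod>i = 1..m. inv_fact_pair k (n i)) = (\<Prod>i\<le>p. inv_fact_pair k (n' i))" for k
    unfolding shift by (intro prod.cong) (auto simp: n'_def mp)
  have n1: "n' 0 = n 1" "n 1 > 0"
    using pos[of 1] m by (auto simp: n'_def)
  then have "qfact (n 1) = (1 - q ^ n 1) * qfact (n 1 - 1)"
    using qfact_Suc[of "n 1 - 1"] by simp
  then have prefactor: "1 / q_int q (n 1) * inverse (q_binomial q (n 1 + n m) (n 1))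
      = (1 - q) * qfact (n 1 - 1) * (qfact (n m) / qfact (n 1 + n m))"
    using q_power_neq_1[OF n1(2)] by (simp add: q_binomial_def q_int_def divide_simps)
  have "1 / q_int q (n 1) * inverse (q_binomial q (n 1 + n m) (n 1)) *
           (\<Sum>k = 1..n 1.
              q_int q (2 * k) * q_int q k ^ (2 * r) *
              q powi (int j * int k ^ 2 - (int r + 1) * int k) *
              (\<Prod>i = 1..m. q_binomial q (n i + n (i + 1)) (n i + k)))
      = (1 - q) * qfact (n 1 - 1) * (qfact (n m) / qfact (n 1 + n m))
          * ((\<Prod>i = 1..m. qfact (n i + n (i + 1)))
             * (\<Sum>k = 1..n 1. weight r k * q ^ (j * k\<^sup>2) * (\<Prod>i\<le>p. inv_fact_pair k (n' i))))"
    unfolding prefactor weight_eq prod_q_binomial_cycle[OF cycle m] pairs sum_distrib_left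
    by (simp only: mult_ac)
  also have "\<dots> = (1 - q) * qfact (n 1 - 1)
          * ((\<Prod>i = 1..m. qfact (n i + n (i + 1))) * qfact (n m)) / qfact (n 1 + n m)
             * (\<Sum>k = 1..n 1. weight r k * q ^ (j * k\<^sup>2) * (\<Prod>i\<le>p. inv_fact_pair k (n' i)))"
    by simp
  also have "\<dots> = path_sum r j p n'"
    unfolding facts path_sum_def n1(1) by simp
  finally show ?thesis
    using path_sum_mem[of n' p j r] n1 j by (simp add: n'_def mp)
qed

end

section \<open>Laurent polynomials with integer coefficients\<close>

lemma qvar_nonzero: "qvar \<noteq> 0"
  by (simp add: qvar_def)

lemma qvar_power_neq_1:
  assumes "n > 0"
  shows "qvar ^ n \<noteq> 1"
proof
  assume "qvar ^ n = 1"
  moreover have "qvar ^ n = to_fract ([:0, 1:] ^ n)"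
    by (induction n) (simp_all add: qvar_def del: mult_pCons_left)
  ultimately have "to_fract ([:0, 1:] ^ n :: rat poly) = to_fract 1"
    by simp
  then have "([:0, 1:] ^ n :: rat poly) = 1"
    by (simp only: to_fract_eq_iff)
  then have "poly ([:0, 1:] ^ n) (0::rat) = 1"
    by simp
  with assms show False
    by (simp add: zero_power)
qed

lemma monomial_mem_int_laurent_polys: "of_int c * qvar powi e \<in> int_laurent_polys"
  unfolding int_laurent_polys_def
  by (rule CollectI, rule exI[of _ "{e}"], rule exI[of _ "\<lambda>_. c"]) simp

lemma int_laurent_polys_diff:
  assumes "x \<in> int_laurent_polys" "y \<in> int_laurent_polys"
  shows "x - y \<in> int_laurent_polys"
proof -
  obtain E c E' c' where x: "finite E" "x = (\<Sum>e\<in>E. of_int (c e) * qvar powi e)"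
    and y: "finite E'" "y = (\<Sum>e\<in>E'. of_int (c' e) * qvar powi e)"
    using assms unfolding int_laurent_polys_def by blast
  let ?d = "\<lambda>e. (if e \<in> E then c e else 0) - (if e \<in> E' then c' e else 0)"
  have "x = (\<Sum>e\<in>E \<union> E'. of_int (if e \<in> E then c e else 0) * qvar powi e)"
    unfolding x(2) by (rule sum.mono_neutral_cong_left) (use x y in auto)
  moreover have "y = (\<Sum>e\<in>E \<union> E'. of_int (if e \<in> E' then c' e else 0) * qvar powi e)"
    unfolding y(2) by (rule sum.mono_neutral_cong_left) (use x y in auto)
  ultimately have "x - y = (\<Sum>e\<in>E \<union> E'. of_int (?d e) * qvar powi e)"
    by (simp only: sum_subtractf [symmetric] of_int_diff left_diff_distrib)
  then show ?thesis
    using x(1) y(1) unfolding int_laurent_polys_def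
    by (intro CollectI exI[of _ "E \<union> E'"] exI[of _ ?d]) auto
qed

lemma int_laurent_polys_sum:
  "(\<And>i. i \<in> S \<Longrightarrow> f i \<in> int_laurent_polys) \<Longrightarrow> sum f S \<in> int_laurent_polys"
proof (induction S rule: infinite_finite_induct)
  case (insert i S)
  have "f i - (0 - sum f S) \<in> int_laurent_polys"
    using insert monomial_mem_int_laurent_polys[of 0 0]
    by (intro int_laurent_polys_diff) auto
  with insert show ?case
    by simp
qed (use monomial_mem_int_laurent_polys[of 0 0] in auto)

lemma int_laurent_polys_mult:
  assumes "x \<in> int_laurent_polys" "y \<in> int_laurent_polys"
  shows "x * y \<in> int_laurent_polys"
proof -
  obtain E c E' c' where x: "x = (\<Sum>e\<in>E. of_int (c e) * qvar powi e)"
    and y: "y = (\<Sum>e\<in>E'. of_int (c' e) * qvar powi e)"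
    using assms unfolding int_laurent_polys_def by blast
  have "x * y = (\<Sum>e\<in>E. \<Sum>e'\<in>E'. of_int (c e * c' e') * qvar powi (e + e'))"
    unfolding x y sum_product by (simp add: power_int_add qvar_nonzero mult_ac)
  then show ?thesis
    by (auto intro!: int_laurent_polys_sum monomial_mem_int_laurent_polys simp del: of_int_mult)
qed

interpretation laurent: generic_q_subring qvar int_laurent_polys
proof
  show "1 \<in> int_laurent_polys"
    using monomial_mem_int_laurent_polys[of 1 0] by simp
  show "qvar \<in> int_laurent_polys"
    using monomial_mem_int_laurent_polys[of 1 1] by simp
  show "inverse qvar \<in> int_laurent_polys"
    using monomial_mem_int_laurent_polys[of 1 "-1"] by (simp add: power_int_minus)
qed (simp_all add: qvar_nonzero qvar_power_neq_1 int_laurent_polys_diff int_laurent_polys_mult)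

theorem theorem1p2:
  fixes m j r :: nat and n :: "nat \<Rightarrow> nat"
  assumes "m \<ge> 1"
    and "\<And>i. i \<in> {1..m} \<Longrightarrow> n i > 0"
    and "n (m + 1) = n 1"
    and "j \<le> m"
  shows "1 / q_int qvar (n 1) * inverse (q_binomial qvar (n 1 + n m) (n 1)) *
           (\<Sum>k = 1..n 1.
              q_int qvar (2 * k) * q_int qvar k ^ (2 * r) *
              qvar powi (int j * int k ^ 2 - (int r + 1) * int k) *
              (\<Prod>i = 1..m. q_binomial qvar (n i + n (i + 1)) (n i + k)))
         \<in> int_laurent_polys"
  using assms by (rule laurent.cyclic_sum_mem)

end
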